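(* For all integers $k\ge 0$ and $n$ with $k<n/2$, $$\operatorname{coind}_{\mathbb{Z}_2}\bigl(S(\mathrm{GHD}_k^n)\bigr)\ge k .$$
   Context: For integers $k<n/2$, $\mathrm{GHD}_k^n$ is the partial sign matrix with rows and columns indexed by $\{0,1\}^n$, given by $\mathrm{GHD}_k^n(x,y)=1$ if $d_H(x,y)\le k$, $-1$ if $d_H(x,y)\ge n-k$, and $*$ otherwise, where $d_H$ is Hamming distance. Sign complex. For a partial sign matrix $A\in\{-1,1,*\}^{M\times N}$ and each row $r$ of $A$, let $\sigma_r^+=\{i^+: r_i=+1\}\cup\{i^-: r_i=-1\}$ and $\sigma_r^-=\{i^-: r_i=+1\}\cup\{i^+: r_i=-1\}$, where $i$ ranges over column indices and $i^+,i^-$ are two disjoint copies of the column index $i$. The sign complex $S(A)$ is the abstract simplicial complex whose simplices are all subsets of $\sigma_r^+$ or $\sigma_r^-$ over all rows $r$. The involution $i^+\leftrightarrow i^-$ is a free simplicial $\mathbb{Z}_2$-action on $S(A)$, inducing a free action on the geometric realization $|S(A)|$. Coindex. For a free $\mathbb{Z}_2$-complex $K$, $\operatorname{coind}_{\mathbb{Z}_2}(K)$ is the maximum $d\ge 0$ for which there is a continuous $\mathbb{Z}_2$-equivariant map $\mathbb{S}^d\to|K|$, where $\mathbb{S}^d$ carries the antipodal action. *)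

theory Defs
  imports "HOL-Analysis.Analysis"
begin

section \<open>Partial sign matrices\<close>

datatype sign_entry = Plus | Minus | Star

text \<open>
  A partial sign matrix is a function \<open>A :: 'r \<Rightarrow> 'c \<Rightarrow> sign_entry\<close> together with finite sets
  of row and column indices; values of \<open>A\<close> outside these sets are irrelevant.
\<close>

definition cube :: "nat \<Rightarrow> bool list set" where
  "cube n = {x. length x = n}"

definition hamming_dist :: "bool list \<Rightarrow> bool list \<Rightarrow> nat" where
  "hamming_dist x y = card {i. i < length x \<and> x ! i \<noteq> y ! i}"

definition GHD :: "nat \<Rightarrow> nat \<Rightarrow> bool list \<Rightarrow> bool list \<Rightarrow> sign_entry" where
  "GHD k n x y =
     (if hamming_dist x y \<le> k then Plus
      else if hamming_dist x y \<ge> n - k then Minus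
      else Star)"


section \<open>Free \<open>\<int>\<^sub>2\<close>-complexes and the coindex\<close>

text \<open>Complexes contain the empty simplex; it does not contribute to the realization.\<close>

definition abstract_simplicial_complex :: "'v set set \<Rightarrow> bool" where
  "abstract_simplicial_complex K \<longleftrightarrow>
     (\<forall>s\<in>K. finite s) \<and> (\<forall>s\<in>K. \<forall>t. t \<subseteq> s \<longrightarrow> t \<in> K)"

text \<open>
  Points of \<open>|K|\<close> are given by their barycentric coordinates. The topology is the one induced
  by the product topology; for finite complexes, the only ones considered here, it is
  the usual topology of the geometric realization.
\<close>

definition realization_points :: "'v set set \<Rightarrow> ('v \<Rightarrow> real) set" where
  "realization_points K =
     {p. (\<forall>v. 0 \<le> p v) \<and> finite {v. p v \<noteq> 0} \<and> {v. p v \<noteq> 0} \<in> K \<and>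
         (\<Sum>v | p v \<noteq> 0. p v) = 1}"

definition realization :: "'v set set \<Rightarrow> ('v \<Rightarrow> real) topology" where
  "realization K = subtopology (powertop_real UNIV) (realization_points K)"

text \<open>
  The affine extension of a vertex map \<open>\<nu>\<close> sends \<open>\<Sum>v. p v \<cdot> v\<close> to \<open>\<Sum>v. p v \<cdot> \<nu> v\<close>. When \<open>\<nu>\<close> is an
  involution, the coordinate of the image at \<open>v\<close> is \<open>p (\<nu> v)\<close>.
\<close>

definition realization_action :: "('v \<Rightarrow> 'v) \<Rightarrow> ('v \<Rightarrow> real) \<Rightarrow> ('v \<Rightarrow> real)" where
  "realization_action \<nu> p = p \<circ> \<nu>"

definition free_Z2_complex :: "'v set set \<Rightarrow> ('v \<Rightarrow> 'v) \<Rightarrow> bool" where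
  "free_Z2_complex K \<nu> \<longleftrightarrow>
     abstract_simplicial_complex K \<and>
     (\<forall>v. \<nu> (\<nu> v) = v) \<and>
     (\<forall>s\<in>K. \<nu> ` s \<in> K) \<and>
     (\<forall>p\<in>realization_points K. realization_action \<nu> p \<noteq> p)"

text \<open>\<open>nsphere d\<close> is the unit sphere of dimension \<open>d\<close> in the space of real sequences.\<close>

definition Z2_map_from_sphere ::
    "nat \<Rightarrow> 'v set set \<Rightarrow> ('v \<Rightarrow> 'v) \<Rightarrow> ((nat \<Rightarrow> real) \<Rightarrow> ('v \<Rightarrow> real)) \<Rightarrow> bool" where
  "Z2_map_from_sphere d K \<nu> f \<longleftrightarrow>
     continuous_map (nsphere d) (realization K) f \<and>
     (\<forall>x\<in>topspace (nsphere d). f (\<lambda>i. - x i) = realization_action \<nu> (f x))"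

text \<open>
  The coindex is extended-real valued, so that it is \<open>\<infinity>\<close> if there are equivariant maps from
  spheres of arbitrarily large dimension and \<open>-\<infinity>\<close> (rather than 0) if there is none at all,
  i.e. for the complex without vertices. Otherwise it is the maximal dimension, as
  \<open>Z2_coind_eqI\<close> shows.
\<close>

definition Z2_coind :: "'v set set \<Rightarrow> ('v \<Rightarrow> 'v) \<Rightarrow> ereal" where
  "Z2_coind K \<nu> = Sup {ereal (real d) | d. \<exists>f. Z2_map_from_sphere d K \<nu> f}"

lemma Z2_coind_eqI:
  assumes "\<exists>f. Z2_map_from_sphere d K \<nu> f"
    and "\<And>d' f. Z2_map_from_sphere d' K \<nu> f \<Longrightarrow> d' \<le> d"
  shows "Z2_coind K \<nu> = ereal (real d)"
  unfolding Z2_coind_def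
  by (rule cSup_eq_maximum) (use assms in \<open>auto simp: ereal_less_eq\<close>)

lemma le_Z2_coind_iff:
  "ereal (real k) \<le> Z2_coind K \<nu> \<longleftrightarrow> (\<exists>d\<ge>k. \<exists>f. Z2_map_from_sphere d K \<nu> f)"
proof
  assume k: "ereal (real k) \<le> Z2_coind K \<nu>"
  show "\<exists>d\<ge>k. \<exists>f. Z2_map_from_sphere d K \<nu> f"
  proof (rule ccontr)
    assume *: "\<not> ?thesis"
    have "real d \<le> real k - 1" if "Z2_map_from_sphere d K \<nu> f" for d f
    proof -
      have "d < k" using * that by (meson not_le)
      then show ?thesis by linarith
    qed
    then have "Z2_coind K \<nu> \<le> ereal (real k - 1)"
      unfolding Z2_coind_def by (intro Sup_least) auto
    with k have "ereal (real k) \<le> ereal (real k - 1)" by (rule order_trans)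
    then show False by simp
  qed
qed (auto simp: Z2_coind_def intro!: Sup_upper2)


section \<open>The sign complex\<close>

text \<open>The two copies of a column index \<open>i\<close> are \<open>Inl i\<close> (for \<open>i\<^sup>+\<close>) and \<open>Inr i\<close> (for \<open>i\<^sup>-\<close>).\<close>

definition sigma_plus :: "'c set \<Rightarrow> ('c \<Rightarrow> sign_entry) \<Rightarrow> ('c + 'c) set" where
  "sigma_plus C r = {Inl i | i. i \<in> C \<and> r i = Plus} \<union> {Inr i | i. i \<in> C \<and> r i = Minus}"

definition sigma_minus :: "'c set \<Rightarrow> ('c \<Rightarrow> sign_entry) \<Rightarrow> ('c + 'c) set" where
  "sigma_minus C r = {Inr i | i. i \<in> C \<and> r i = Plus} \<union> {Inl i | i. i \<in> C \<and> r i = Minus}"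

definition sign_complex ::
    "'r set \<Rightarrow> 'c set \<Rightarrow> ('r \<Rightarrow> 'c \<Rightarrow> sign_entry) \<Rightarrow> ('c + 'c) set set" where
  "sign_complex R C A =
     {s. \<exists>r\<in>R. s \<subseteq> sigma_plus C (A r) \<or> s \<subseteq> sigma_minus C (A r)}"

definition sign_swap :: "'c + 'c \<Rightarrow> 'c + 'c" where
  "sign_swap = case_sum Inr Inl"

lemma sign_swap_simps [simp]:
  "sign_swap (Inl i) = Inr i" "sign_swap (Inr i) = Inl i" "sign_swap (sign_swap v) = v"
  by (cases v; simp add: sign_swap_def)+

lemma finite_sigma:
  assumes "finite C"
  shows "finite (sigma_plus C r)" "finite (sigma_minus C r)"
  using assms by (auto simp: sigma_plus_def sigma_minus_def)

lemma sign_swap_image_sigma: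
  "sign_swap ` sigma_plus C r = sigma_minus C r"
  "sign_swap ` sigma_minus C r = sigma_plus C r"
  unfolding sigma_plus_def sigma_minus_def by (auto simp: image_iff; force)+

lemma sign_swap_notin_sigma:
  "v \<in> sigma_plus C r \<Longrightarrow> sign_swap v \<notin> sigma_plus C r"
  "v \<in> sigma_minus C r \<Longrightarrow> sign_swap v \<notin> sigma_minus C r"
  by (auto simp: sigma_plus_def sigma_minus_def)

lemma free_Z2_complex_sign_complex:
  assumes "finite C"
  shows "free_Z2_complex (sign_complex R C A) sign_swap"
  unfolding free_Z2_complex_def
proof (intro conjI ballI allI)
  show "abstract_simplicial_complex (sign_complex R C A)"
    unfolding abstract_simplicial_complex_def sign_complex_def
    using finite_sigma[OF assms] by (blast intro: finite_subset)
next
  fix s assume "s \<in> sign_complex R C A"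
  then show "sign_swap ` s \<in> sign_complex R C A"
    unfolding sign_complex_def mem_Collect_eq
    by (metis image_mono sign_swap_image_sigma)
next
  fix p assume p: "p \<in> realization_points (sign_complex R C A)"
  let ?S = "{v. p v \<noteq> 0}"
  from p have "?S \<noteq> {}"
    unfolding realization_points_def by (metis (mono_tags, lifting) mem_Collect_eq sum.empty zero_neq_one)
  then obtain v where v: "v \<in> ?S" by blast
  from p obtain r where "?S \<subseteq> sigma_plus C (A r) \<or> ?S \<subseteq> sigma_minus C (A r)"
    by (auto simp: realization_points_def sign_complex_def)
  with v have "sign_swap v \<notin> ?S"
    using sign_swap_notin_sigma by (meson subsetD)
  with v show "realization_action sign_swap p \<noteq> p"
    by (metis (mono_tags) comp_apply mem_Collect_eq realization_action_def)
qed simp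

end

theory Submission
  imports Defs
begin

text \<open>
  A sphere of dimension \<open>k\<close> maps equivariantly to the \<open>k\<close>-skeleton of the cube \<open>[-1,1]\<^sup>n\<close>, and
  the \<open>k\<close>-skeleton of the cube maps equivariantly to the sign complex.

  For the second map, a point \<open>w\<close> of the cube determines the product distribution on its vertices
  with mean \<open>w\<close>. If \<open>w\<close> lies in a \<open>k\<close>-dimensional face, this distribution is supported on the
  vertices of that face, and any two of them are at Hamming distance at most \<open>k\<close>
  (\<open>hamming_dist_support_le\<close>). So the support of the distribution lies in the Hamming ball of
  radius \<open>k\<close> around any vertex \<open>r\<close> of the face, and these vertices taken as positive columns belong
  to the simplex \<open>\<sigma>\<^sub>r\<^sup>+\<close>. Their antipodes, at distance at least \<open>n - k\<close> from \<open>r\<close>, belong to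
  \<open>\<sigma>\<^sub>r\<^sup>+\<close> as negative columns, because \<open>k < n - k\<close>. Giving half of the mass to each of the two copies turns the
  antipodal symmetry of the cube into the exchange of the signs
  (\<open>sign_point_in_realization\<close>, \<open>sign_point_uminus\<close>).

  For the first map, a unit vector \<open>v\<close> of \<open>\<real>\<^sup>k\<^sup>+\<^sup>1\<close> is read as the nonzero polynomial of degree at
  most \<open>k\<close> with coefficients \<open>v\<close>, and is sent to the values of the polynomial at the points
  \<open>0, \<dots>, n-1\<close>. At most \<open>k\<close> of these values vanish. Scaling them by a large enough factor, which
  can be chosen continuous and even in \<open>v\<close>, and truncating to \<open>[-1,1]\<close> makes all but at most \<open>k\<close> of them
  equal to \<open>1\<close> or \<open>-1\<close> (\<open>card_truncated_less_one\<close>).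
\<close>

section \<open>Product distributions on the vertices of a cube\<close>

text \<open>
  The vertex \<open>x\<close> of the cube \<open>[-1,1]\<^sup>n\<close> has coordinate \<open>1\<close> where \<open>x\<close> is true and \<open>-1\<close> elsewhere;
  \<open>cube_weight n w\<close> is the product distribution with barycentre \<open>w\<close>.
\<close>

definition cube_weight :: "nat \<Rightarrow> (nat \<Rightarrow> real) \<Rightarrow> bool list \<Rightarrow> real" where
  "cube_weight n w x =
     (if length x = n then \<Prod>i<n. (1 + (if x ! i then w i else - w i)) / 2 else 0)"

lemma cube_weight_nonneg:
  assumes "\<And>i. i < n \<Longrightarrow> \<bar>w i\<bar> \<le> 1"
  shows "0 \<le> cube_weight n w x"
proof -
  have "0 \<le> (1 + (if x ! i then w i else - w i)) / 2" if "i < n" for i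
    using assms[OF that] by (auto simp: abs_le_iff)
  then show ?thesis
    by (auto simp: cube_weight_def intro!: prod_nonneg)
qed

lemma cube_weight_uminus: "cube_weight n (\<lambda>i. - w i) x = cube_weight n w (map Not x)"
  by (auto simp: cube_weight_def intro!: prod.cong)

lemma finite_cube: "finite (cube n)"
  using finite_lists_length_eq[of "UNIV :: bool set" n] by (simp add: cube_def)

lemma cube_Suc: "cube (Suc n) = (#) True ` cube n \<union> (#) False ` cube n"
  by (auto simp: cube_def length_Suc_conv image_iff)

lemma sum_cube_weight: "(\<Sum>x\<in>cube n. cube_weight n w x) = 1"
proof (induction n arbitrary: w)
  case 0
  have "cube 0 = {[]}" by (auto simp: cube_def)
  then show ?case by (simp add: cube_weight_def)
next
  case (Suc n)
  let ?w = "\<lambda>i. w (Suc i)"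
  have Cons: "cube_weight (Suc n) w (b # x) = (1 + (if b then w 0 else - w 0)) / 2 * cube_weight n ?w x"
    for b x
    by (simp add: cube_weight_def prod.lessThan_Suc_shift del: prod.lessThan_Suc)
  have "(\<Sum>x\<in>cube (Suc n). cube_weight (Suc n) w x)
      = (\<Sum>x\<in>(#) True ` cube n. cube_weight (Suc n) w x)
      + (\<Sum>x\<in>(#) False ` cube n. cube_weight (Suc n) w x)"
    unfolding cube_Suc by (rule sum.union_disjoint) (auto simp: finite_cube)
  also have "\<dots> = (1 + w 0) / 2 * (\<Sum>x\<in>cube n. cube_weight n ?w x)
      + (1 - w 0) / 2 * (\<Sum>x\<in>cube n. cube_weight n ?w x)"
    by (simp add: sum.reindex inj_on_def Cons sum_distrib_left)
  also have "\<dots> = 1"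
    by (simp add: Suc.IH field_simps)
  finally show ?case .
qed

text \<open>
  Where \<open>w i\<close> is \<open>1\<close> or \<open>-1\<close>, one of the two possible factors of the product vanishes, so all
  vertices in the support have the same entry at \<open>i\<close>.
\<close>

lemma hamming_dist_support_le:
  assumes "cube_weight n w x \<noteq> 0" "cube_weight n w y \<noteq> 0"
    and "card {i. i < n \<and> \<bar>w i\<bar> \<noteq> 1} \<le> k"
  shows "hamming_dist x y \<le> k"
proof -
  have len: "length x = n"
    using assms(1) by (auto simp: cube_weight_def split: if_splits)
  have nonzero: "1 + (if z ! i then w i else - w i) \<noteq> 0"
    if "cube_weight n w z \<noteq> 0" "i < n" for z i
    using that by (auto simp: cube_weight_def split: if_splits)
  have "{i. i < length x \<and> x ! i \<noteq> y ! i} \<subseteq> {i. i < n \<and> \<bar>w i\<bar> \<noteq> 1}"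
  proof
    fix i assume "i \<in> {i. i < length x \<and> x ! i \<noteq> y ! i}"
    then have i: "i < n" and ne: "x ! i \<noteq> y ! i" using len by auto
    have "\<bar>w i\<bar> \<noteq> 1"
    proof
      assume "\<bar>w i\<bar> = 1"
      then have "w i = 1 \<or> w i = - 1" by linarith
      then show False
        using nonzero[OF assms(1) i] nonzero[OF assms(2) i] ne by (cases "x ! i") auto
    qed
    with i show "i \<in> {i. i < n \<and> \<bar>w i\<bar> \<noteq> 1}" by simp
  qed
  then have "hamming_dist x y \<le> card {i. i < n \<and> \<bar>w i\<bar> \<noteq> 1}"
    unfolding hamming_dist_def by (intro card_mono) auto
  with assms(3) show ?thesis by simp
qed

lemma hamming_dist_map_Not:
  assumes "length y = length x"
  shows "hamming_dist x y + hamming_dist x (map Not y) = length x"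
proof -
  have "{i. i < length x \<and> x ! i \<noteq> y ! i} \<union> {i. i < length x \<and> x ! i \<noteq> map Not y ! i}
      = {..<length x}"
    using assms by auto
  moreover have "{i. i < length x \<and> x ! i \<noteq> y ! i} \<inter> {i. i < length x \<and> x ! i \<noteq> map Not y ! i}
      = {}"
    using assms by auto
  ultimately show ?thesis
    unfolding hamming_dist_def by (subst card_Un_disjoint[symmetric]) auto
qed

section \<open>The skeleton of the cube and the sign complex\<close>

text \<open>
  The negative copy of a column is a stand-in for the positive copy of its antipode, and gets the
  same mass.
\<close>

definition sign_point :: "nat \<Rightarrow> (nat \<Rightarrow> real) \<Rightarrow> bool list + bool list \<Rightarrow> real" where
  "sign_point n w = case_sum (\<lambda>x. cube_weight n w x / 2) (\<lambda>x. cube_weight n w (map Not x) / 2)"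

lemma sign_point_simps [simp]:
  "sign_point n w (Inl x) = cube_weight n w x / 2"
  "sign_point n w (Inr x) = cube_weight n w (map Not x) / 2"
  by (simp_all add: sign_point_def)

lemma sign_point_uminus:
  "sign_point n (\<lambda>i. - w i) = realization_action sign_swap (sign_point n w)"
proof
  fix v show "sign_point n (\<lambda>i. - w i) v = realization_action sign_swap (sign_point n w) v"
    by (cases v) (simp_all add: realization_action_def cube_weight_uminus comp_def)
qed

lemma continuous_on_sign_point:
  assumes "\<And>i. i < n \<Longrightarrow> continuous_on S (\<lambda>v. w v i)"
  shows "continuous_on S (\<lambda>v. sign_point n (w v))"
proof -
  have "continuous_on S (\<lambda>v. cube_weight n (w v) x)" for x
  proof (cases "length x = n")
    case True
    have "continuous_on S (\<lambda>v. if x ! i then w v i else - w v i)" if "i < n" for i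
      using assms[OF that] by (cases "x ! i") (auto intro: continuous_intros)
    then show ?thesis
      using True by (auto simp: cube_weight_def intro!: continuous_intros)
  qed (simp add: cube_weight_def)
  then have "continuous_on S (\<lambda>v. sign_point n (w v) u)" for u
    by (cases u) (auto intro!: continuous_intros)
  then show ?thesis
    by (rule continuous_on_coordinatewise_then_product)
qed

lemma sum_sign_point: "(\<Sum>v\<in>cube n <+> cube n. sign_point n w v) = 1"
proof -
  have "(\<Sum>x\<in>cube n. cube_weight n w (map Not x)) = (\<Sum>x\<in>cube n. cube_weight n (\<lambda>i. - w i) x)"
    by (simp add: cube_weight_uminus)
  then show ?thesis
    by (simp add: sum.Plus finite_cube sum_cube_weight flip: sum_divide_distrib)
qed

text \<open>
  The row that witnesses membership in the sign complex is any vertex in the support of the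
  product distribution.
\<close>

lemma sign_point_in_realization:
  assumes "k < n - k" and "\<And>i. i < n \<Longrightarrow> \<bar>w i\<bar> \<le> 1"
    and card: "card {i. i < n \<and> \<bar>w i\<bar> \<noteq> 1} \<le> k"
  shows "sign_point n w \<in> realization_points (sign_complex (cube n) (cube n) (GHD k n))"
proof -
  let ?p = "sign_point n w"
  have support_cube: "x \<in> cube n" if "cube_weight n w x \<noteq> 0" for x
    using that by (auto simp: cube_weight_def cube_def split: if_splits)
  obtain r where r: "cube_weight n w r \<noteq> 0" "r \<in> cube n"
    using sum_cube_weight[of n w] by (metis sum.not_neutral_contains_not_neutral zero_neq_one)
  have simplex: "{v. ?p v \<noteq> 0} \<subseteq> sigma_plus (cube n) (GHD k n r)"
  proof
    fix v assume v: "v \<in> {v. ?p v \<noteq> 0}"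
    show "v \<in> sigma_plus (cube n) (GHD k n r)"
    proof (cases v)
      case (Inl x)
      then have x: "cube_weight n w x \<noteq> 0" using v by simp
      then show ?thesis
        using Inl support_cube[OF x] hamming_dist_support_le[OF r(1) x card]
        by (auto simp: sigma_plus_def GHD_def)
    next
      case (Inr x)
      then have x: "cube_weight n w (map Not x) \<noteq> 0" using v by simp
      have "hamming_dist r (map Not x) \<le> k"
        by (rule hamming_dist_support_le[OF r(1) x card])
      moreover have "x \<in> cube n" using support_cube[OF x] by (simp add: cube_def)
      moreover from this have "hamming_dist r x + hamming_dist r (map Not x) = n"
        using hamming_dist_map_Not[of x r] r(2) by (simp add: cube_def)
      ultimately show ?thesis
        using Inr assms(1) by (auto simp: sigma_plus_def GHD_def)
    qed
  qed
  have sub: "{v. ?p v \<noteq> 0} \<subseteq> cube n <+> cube n"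
    using simplex by (auto simp: sigma_plus_def)
  have "(\<Sum>v | ?p v \<noteq> 0. ?p v) = (\<Sum>v\<in>cube n <+> cube n. ?p v)"
    using sub by (intro sum.mono_neutral_left) (auto simp: finite_cube)
  moreover have "0 \<le> ?p v" for v
    using cube_weight_nonneg[of n w] assms(2) by (cases v) auto
  moreover have "finite {v. ?p v \<noteq> 0}"
    using sub by (rule finite_subset) (simp add: finite_cube)
  moreover have "{v. ?p v \<noteq> 0} \<in> sign_complex (cube n) (cube n) (GHD k n)"
    using simplex r(2) by (auto simp: sign_complex_def)
  ultimately show ?thesis
    by (simp add: realization_points_def sum_sign_point)
qed

section \<open>From the sphere to the skeleton of the cube\<close>

definition poly_value :: "nat \<Rightarrow> (nat \<Rightarrow> real) \<Rightarrow> nat \<Rightarrow> real" where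
  "poly_value k v j = (\<Sum>i\<le>k. v i * real j ^ i)"

text \<open>
  An even function of \<open>v\<close> that is at least \<open>(k+1) / (\<Sum>j\<in>T. \<bar>p(j)\<bar>)\<close> for every set \<open>T\<close> of \<open>k + 1\<close>
  of the points \<open>0, \<dots>, n-1\<close>, where \<open>p\<close> is the polynomial of \<open>v\<close>. Summing over all \<open>T\<close> rather than maximizing makes
  its continuity evident.
\<close>

definition poly_scale :: "nat \<Rightarrow> nat \<Rightarrow> (nat \<Rightarrow> real) \<Rightarrow> real" where
  "poly_scale k n v =
     (\<Sum>T | T \<subseteq> {..<n} \<and> card T = Suc k. real (Suc k) / (\<Sum>j\<in>T. \<bar>poly_value k v j\<bar>))"

definition poly_cube_point :: "nat \<Rightarrow> nat \<Rightarrow> (nat \<Rightarrow> real) \<Rightarrow> nat \<Rightarrow> real" where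
  "poly_cube_point k n v j = max (-1) (min 1 (poly_scale k n v * poly_value k v j))"

lemma poly_value_uminus: "poly_value k (\<lambda>i. - v i) j = - poly_value k v j"
  by (simp add: poly_value_def sum_negf)

lemma poly_cube_point_uminus:
  "poly_cube_point k n (\<lambda>i. - v i) = (\<lambda>j. - poly_cube_point k n v j)"
  by (rule ext) (auto simp: poly_cube_point_def poly_scale_def poly_value_uminus max_def min_def)

text \<open>A nonzero polynomial of degree at most \<open>k\<close> has at most \<open>k\<close> roots, so it is nonzero somewhere on \<open>T\<close>.\<close>

lemma sum_abs_poly_value_pos:
  assumes "i \<le> k" "v i \<noteq> 0" "card T = Suc k"
  shows "0 < (\<Sum>j\<in>T. \<bar>poly_value k v j\<bar>)"
proof -
  let ?Z = "{z::real. (\<Sum>i\<le>k. v i * z ^ i) = 0}"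
  have Z: "finite ?Z" "card ?Z \<le> k"
    using Transcendental.polyfun_rootbound[of v i k] assms(1,2) by simp_all
  have fin: "finite T" using assms(3) by (auto intro: card_ge_0_finite)
  have "\<not> real ` T \<subseteq> ?Z"
  proof
    assume "real ` T \<subseteq> ?Z"
    then have "card (real ` T) \<le> k" using Z card_mono le_trans by blast
    moreover have "card (real ` T) = card T" by (intro card_image inj_onI) simp
    ultimately show False using assms(3) by simp
  qed
  then obtain j where "j \<in> T" "poly_value k v j \<noteq> 0"
    by (auto simp: poly_value_def)
  then show ?thesis using fin by (intro sum_pos2[where i = j]) auto
qed

text \<open>
  If all values on a set \<open>T\<close> of \<open>k + 1\<close> points were still less than \<open>1\<close> in absolute value after
  scaling, their sum would be less than \<open>k + 1\<close>; but the term of the scaling factor that belongs to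
  \<open>T\<close> alone makes this sum at least \<open>k + 1\<close>.
\<close>

lemma card_truncated_less_one:
  assumes "i \<le> k" "v i \<noteq> 0"
  shows "card {j. j < n \<and> \<bar>poly_cube_point k n v j\<bar> \<noteq> 1} \<le> k"
proof (rule ccontr)
  let ?s = "poly_scale k n v"
  assume "\<not> ?thesis"
  then have "Suc k \<le> card {j. j < n \<and> \<bar>poly_cube_point k n v j\<bar> \<noteq> 1}" by simp
  then obtain T where T: "T \<subseteq> {j. j < n \<and> \<bar>poly_cube_point k n v j\<bar> \<noteq> 1}" "card T = Suc k"
    by (rule obtain_subset_with_card_n)
  let ?S = "\<Sum>j\<in>T. \<bar>poly_value k v j\<bar>"
  have pos: "0 < ?S" using sum_abs_poly_value_pos[of i k v T] assms T(2) by simp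
  have fin: "finite T" "T \<noteq> {}" using T(2) by (auto intro: card_ge_0_finite)
  have "real (Suc k) / ?S \<le> ?s"
    unfolding poly_scale_def
  proof (rule member_le_sum)
    show "finite {T. T \<subseteq> {..<n} \<and> card T = Suc k}"
      by (rule finite_subset[of _ "Pow {..<n}"]) auto
  qed (use T in \<open>auto simp: sum_nonneg\<close>)
  then have ge: "real (Suc k) \<le> ?s * ?S" using pos by (simp add: pos_divide_le_eq)
  have "\<bar>?s * poly_value k v j\<bar> < 1" if "j \<in> T" for j
  proof -
    have "\<bar>max (-1) (min 1 t)\<bar> \<noteq> 1 \<Longrightarrow> \<bar>t\<bar> < 1" for t :: real by linarith
    then show ?thesis using that T(1) by (auto simp: poly_cube_point_def)
  qed
  then have "(\<Sum>j\<in>T. \<bar>?s * poly_value k v j\<bar>) < (\<Sum>j\<in>T. 1)"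
    using fin by (intro sum_strict_mono) auto
  moreover have "?s * ?S \<le> (\<Sum>j\<in>T. \<bar>?s * poly_value k v j\<bar>)"
    unfolding sum_distrib_left abs_mult by (intro sum_mono mult_right_mono) auto
  ultimately show False using ge T(2) by simp
qed

lemma continuous_on_poly_cube_point:
  assumes "\<And>v. v \<in> S \<Longrightarrow> \<exists>i\<le>k. v i \<noteq> 0"
  shows "continuous_on S (\<lambda>v. poly_cube_point k n v j)"
proof -
  have cont_value: "continuous_on S (\<lambda>v. poly_value k v j)" for j
    unfolding poly_value_def
    by (intro continuous_intros continuous_on_subset[OF continuous_on_product_coordinates]) auto
  have "(\<Sum>j\<in>T. \<bar>poly_value k v j\<bar>) \<noteq> 0" if "v \<in> S" "card T = Suc k" for v T
    using assms[OF that(1)] sum_abs_poly_value_pos[OF _ _ that(2)] by fastforce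
  then have "continuous_on S (poly_scale k n)"
    unfolding poly_scale_def by (intro continuous_intros cont_value) auto
  then show ?thesis
    unfolding poly_cube_point_def by (intro continuous_intros cont_value)
qed

theorem theorem17:
  fixes k n :: nat
  assumes "real k < real n / 2"
  shows "Z2_coind (sign_complex (cube n) (cube n) (GHD k n)) sign_swap \<ge> ereal (real k)"
proof -
  let ?K = "sign_complex (cube n) (cube n) (GHD k n)"
  let ?S = "topspace (nsphere k)"
  let ?f = "\<lambda>v. sign_point n (poly_cube_point k n v)"
  have nonzero: "\<exists>i\<le>k. v i \<noteq> 0" if "v \<in> ?S" for v
  proof (rule ccontr)
    assume "\<not> ?thesis"
    then have "(\<Sum>i\<le>k. (v i)\<^sup>2) = 0" by simp
    with that show False by (simp add: nsphere)
  qed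
  have sphere: "nsphere k = top_of_set ?S"
    by (simp add: nsphere euclidean_product_topology)
  have "continuous_on ?S ?f"
    by (intro continuous_on_sign_point continuous_on_poly_cube_point nonzero)
  then have "continuous_map (nsphere k) euclidean ?f"
    by (subst sphere) simp
  moreover have "?f v \<in> realization_points ?K" if v: "v \<in> ?S" for v
  proof (rule sign_point_in_realization)
    show "k < n - k" using assms by linarith
    show "\<bar>poly_cube_point k n v i\<bar> \<le> 1" for i by (simp add: poly_cube_point_def)
    show "card {j. j < n \<and> \<bar>poly_cube_point k n v j\<bar> \<noteq> 1} \<le> k"
      using nonzero[OF v] card_truncated_less_one by blast
  qed
  ultimately have "continuous_map (nsphere k) (realization ?K) ?f"
    by (auto simp: realization_def continuous_map_in_subtopology euclidean_product_topology)
  then have "Z2_map_from_sphere k ?K sign_swap ?f"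
    by (simp add: Z2_map_from_sphere_def poly_cube_point_uminus sign_point_uminus)
  then show ?thesis
    unfolding le_Z2_coind_iff by blast
qed

end
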